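(* Let $\mathcal{H}$ be a complex Hilbert space and let $T:\mathbb{Z}\oplus\mathbb{Z}\to\mathcal{B}(\mathcal{H})$ be a function. Then the following are equivalent. (1) $T$ is a positive definite function. (2) For every $n\in\mathbb{N}$, the block matrix $$\Delta_{n+1}=\big[\,T(t_1-s_1,\;t_2-s_2)\,\big]_{(s_1,s_2),(t_1,t_2)\in\{0,1,\dots,n\}^2},$$ whose rows are indexed by $(s_1,s_2)$ and columns by $(t_1,t_2)$, both ordered lexicographically, defines a positive operator on $\mathcal{H}^{(n+1)^2}$.
   Context: $\mathcal{B}(\mathcal{H})$ is the algebra of bounded linear operators on $\mathcal{H}$; "positive" for an operator $A$ means $\langle Ax,x\rangle\ge 0$ for all $x$. For a group $G$, a map $T:G\to\mathcal{B}(\mathcal{H})$ is positive definite if $T(s^{-1})=T(s)^*$ for every $s\in G$ and $\sum_{s\in G}\sum_{t\in G}\langle T(t^{-1}s)h(s),h(t)\rangle\ge 0$ for every finitely supported function $h:G\to\mathcal{H}$. Here $G=\mathbb{Z}\oplus\mathbb{Z}$ is written additively. Lexicographic order: $(i_1,j_1)<(i_2,j_2)$ if $i_1<i_2$, or $i_1=i_2$ and $j_1<j_2$. *)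

theory Defs
  imports
    "HOL-Analysis.Inner_Product"
    "HOL-Library.Product_Plus"
    "HOL-Library.Product_Lexorder"
    "HOL-Library.Nonpos_Ints"
begin

text \<open>
  Complex Hilbert spaces. The inner product is linear in the first argument; the norm and
  topology are those of the underlying real inner product space, whose inner product
  is the real part of the complex one.
\<close>

class complex_vector = real_vector +
  fixes scaleC :: "complex \<Rightarrow> 'a \<Rightarrow> 'a" (infixr \<open>*\<^sub>C\<close> 75)
  assumes scaleC_add_right: "c *\<^sub>C (x + y) = c *\<^sub>C x + c *\<^sub>C y"
    and scaleC_add_left: "(c + d) *\<^sub>C x = c *\<^sub>C x + d *\<^sub>C x"
    and scaleC_scaleC: "c *\<^sub>C d *\<^sub>C x = (c * d) *\<^sub>C x"
    and scaleR_scaleC: "r *\<^sub>R x = complex_of_real r *\<^sub>C x"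

class complex_inner = complex_vector + real_inner +
  fixes cinner :: "'a \<Rightarrow> 'a \<Rightarrow> complex"
  assumes cinner_commute: "cinner x y = cnj (cinner y x)"
    and cinner_add_left: "cinner (x + y) z = cinner x z + cinner y z"
    and cinner_scaleC_left: "cinner (c *\<^sub>C x) y = c * cinner x y"
    and inner_eq_Re_cinner: "inner x y = Re (cinner x y)"

class chilbert_space = complex_inner + complete_space

instantiation complex :: chilbert_space
begin

definition scaleC_complex :: "complex \<Rightarrow> complex \<Rightarrow> complex" where
  "scaleC_complex c x = c * x"

definition cinner_complex :: "complex \<Rightarrow> complex \<Rightarrow> complex" where
  "cinner_complex x y = x * cnj y"

instance
  by standard
    (auto simp: scaleC_complex_def cinner_complex_def inner_complex_def algebra_simps
      scaleR_conv_of_real)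

end

definition bounded_clinear :: "('a::complex_inner \<Rightarrow> 'b::complex_inner) \<Rightarrow> bool" where
  "bounded_clinear A \<longleftrightarrow> bounded_linear A \<and> (\<forall>c x. A (c *\<^sub>C x) = c *\<^sub>C A x)"

text \<open>
  For bounded operators on a Hilbert space the description below determines exactly one map,
  by the Riesz representation theorem.
\<close>

definition cadjoint :: "('a::chilbert_space \<Rightarrow> 'a) \<Rightarrow> 'a \<Rightarrow> 'a" where
  "cadjoint A = (THE B. \<forall>x y. cinner (A x) y = cinner x (B y))"

text \<open>
  The group is written additively, so \<open>t\<inverse>s\<close> becomes \<open>- t + s\<close>. Both sums over the
  group reduce to the support of \<open>h\<close>. Membership in \<open>\<real>\<^sub>\<ge>\<^sub>0\<close> says that a complex
  number is real and nonnegative.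
\<close>

definition positive_definite :: "('g::group_add \<Rightarrow> 'a::chilbert_space \<Rightarrow> 'a) \<Rightarrow> bool" where
  "positive_definite T \<longleftrightarrow>
     (\<forall>s. T (- s) = cadjoint (T s)) \<and>
     (\<forall>h :: 'g \<Rightarrow> 'a. finite {s. h s \<noteq> 0} \<longrightarrow>
        (\<Sum>s | h s \<noteq> 0. \<Sum>t | h t \<noteq> 0. cinner (T (- t + s) (h s)) (h t)) \<in> \<real>\<^sub>\<ge>\<^sub>0)"

text \<open>
  The Hilbert space \<open>H\<^sup>N\<close>, with \<open>N\<close> a natural number, consists of the sequences that
  vanish from index \<open>N\<close> on. A block matrix \<open>M\<close> has entries \<open>M i j\<close> (row \<open>i\<close>, column
  \<open>j\<close>), which are operators on \<open>H\<close>, for \<open>i, j < N\<close>.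
\<close>

definition power_space :: "nat \<Rightarrow> (nat \<Rightarrow> 'a::complex_inner) set" where
  "power_space N = {x. \<forall>i\<ge>N. x i = 0}"

definition power_cinner :: "nat \<Rightarrow> (nat \<Rightarrow> 'a::complex_inner) \<Rightarrow> (nat \<Rightarrow> 'a) \<Rightarrow> complex" where
  "power_cinner N x y = (\<Sum>i<N. cinner (x i) (y i))"

definition block_operator ::
  "nat \<Rightarrow> (nat \<Rightarrow> nat \<Rightarrow> 'a::complex_inner \<Rightarrow> 'a) \<Rightarrow> (nat \<Rightarrow> 'a) \<Rightarrow> nat \<Rightarrow> 'a" where
  "block_operator N M x = (\<lambda>i. if i < N then \<Sum>j<N. M i j (x j) else 0)"

definition positive_on_power ::
  "nat \<Rightarrow> ((nat \<Rightarrow> 'a::complex_inner) \<Rightarrow> nat \<Rightarrow> 'a) \<Rightarrow> bool" where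
  "positive_on_power N A \<longleftrightarrow> (\<forall>x\<in>power_space N. power_cinner N (A x) x \<in> \<real>\<^sub>\<ge>\<^sub>0)"

text \<open>
  Sorting is with respect to the lexicographic order on pairs from
  \<^theory>\<open>HOL-Library.Product_Lexorder\<close>.
\<close>

definition lex_indices :: "nat \<Rightarrow> (nat \<times> nat) list" where
  "lex_indices n = sorted_list_of_set ({0..n} \<times> {0..n})"

text \<open>\<open>Delta T n\<close> is the block matrix \<open>\<Delta>\<^bsub>n+1\<^esub>\<close>.\<close>

definition Delta :: "(int \<times> int \<Rightarrow> 'a \<Rightarrow> 'a) \<Rightarrow> nat \<Rightarrow> nat \<Rightarrow> nat \<Rightarrow> 'a \<Rightarrow> 'a" where
  "Delta T n i j =
     (let (s1, s2) = lex_indices n ! i; (t1, t2) = lex_indices n ! j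
      in T (int t1 - int s1, int t2 - int s2))"

end

theory Submission
  imports Defs
begin

text \<open>
  Up to the enumeration of the index square, the quadratic form of \<open>\<Delta>\<^bsub>n+1\<^esub>\<close> is the
  double sum in the definition of positive definiteness, restricted to functions supported in
  \<open>{0..n}\<^sup>2\<close>. This double sum is invariant under translation of the function, and
  every finite subset of the group can be translated into such a square. The symmetry condition
  comes for free: if the double sums over the points \<open>0\<close> and \<open>g\<close> are real, so is
  \<open>\<langle>T(g) y, x\<rangle> + \<langle>T(-g) x, y\<rangle>\<close> for all \<open>x\<close> and \<open>y\<close>, and
  replacing \<open>y\<close> by \<open>\<i>y\<close> shows that the two terms are conjugate to each other.
\<close>

lemma cinner_zero_left [simp]: "cinner 0 (y :: 'a::complex_inner) = 0"
  using cinner_add_left[of 0 0 y] by simp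

lemma cinner_zero_right [simp]: "cinner (x :: 'a::complex_inner) 0 = 0"
  by (subst cinner_commute) simp

lemma cinner_add_right: "cinner (x :: 'a::complex_inner) (y + z) = cinner x y + cinner x z"
  using cinner_commute[of x] cinner_add_left[of y z x] by simp

lemma cinner_scaleC_right: "cinner (x :: 'a::complex_inner) (c *\<^sub>C y) = cnj c * cinner x y"
  using cinner_commute[of x] cinner_scaleC_left[of c y x] by simp

lemma cinner_sum_left: "cinner (sum f A) (y :: 'a::complex_inner) = (\<Sum>i\<in>A. cinner (f i) y)"
  by (induction A rule: infinite_finite_induct) (simp_all add: cinner_add_left)

text \<open>Nondegeneracy: testing against \<open>x = a - b\<close> and taking real parts gives
  \<open>inner (a - b) (a - b) = 0\<close>.\<close>

lemma cinner_ext: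
  fixes a b :: "'a::complex_inner"
  assumes "\<And>x. cinner x a = cinner x b"
  shows "a = b"
proof -
  have "inner (a - b) a = inner (a - b) b"
    by (simp add: inner_eq_Re_cinner assms)
  then have "inner (a - b) (a - b) = 0"
    by (simp add: inner_diff_right)
  then show ?thesis by simp
qed

lemma cadjoint_eqI:
  fixes A B :: "'a::chilbert_space \<Rightarrow> 'a"
  assumes "\<And>x y. cinner (A x) y = cinner x (B y)"
  shows "cadjoint A = B"
  unfolding cadjoint_def
proof (rule the_equality)
  show "C = B" if "\<forall>x y. cinner (A x) y = cinner x (C y)" for C
    by (rule ext, rule cinner_ext) (metis assms that)
qed (use assms in blast)

lemma bounded_clinear_add: "bounded_clinear A \<Longrightarrow> A (x + y) = A x + A y"
  by (simp add: bounded_clinear_def bounded_linear.linear linear_add)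

lemma bounded_clinear_zero: "bounded_clinear A \<Longrightarrow> A 0 = 0"
  by (simp add: bounded_clinear_def bounded_linear.linear linear_0)

lemma bounded_clinear_scaleC: "bounded_clinear A \<Longrightarrow> A (c *\<^sub>C x) = c *\<^sub>C A x"
  by (simp add: bounded_clinear_def)

lemma cinner_adjoint_if_real:
  fixes A B :: "'a::complex_inner \<Rightarrow> 'a"
  assumes "bounded_clinear A"
    and real: "\<And>x y. Im (cinner (A y) x + cinner (B x) y) = 0"
  shows "cinner (A y) x = cinner y (B x)"
proof -
  have "Im (cinner (A y) x + cinner (B x) y) = 0"
    by (rule real)
  \<comment> \<open>The minus sign comes from conjugate linearity in the second slot. This equation
    equates the real parts of the two inner products; the previous one makes their imaginary parts
    opposite.\<close>
  moreover have "Im (\<i> * cinner (A y) x - \<i> * cinner (B x) y) = 0"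
    using real[where x = x and y = "\<i> *\<^sub>C y"] assms(1)
    by (simp add: bounded_clinear_scaleC cinner_scaleC_left cinner_scaleC_right)
  ultimately have "cinner (A y) x = cnj (cinner (B x) y)"
    by (simp add: complex_eq_iff)
  then show ?thesis
    by (simp add: cinner_commute[of y])
qed

text \<open>Summing over a separate set \<open>F\<close> instead of the support of \<open>h\<close>
  lets the set be translated or enlarged explicitly; values of \<open>h\<close> outside
  \<open>F\<close> are ignored.\<close>

definition pd_form :: "('g::group_add \<Rightarrow> 'a::chilbert_space \<Rightarrow> 'a) \<Rightarrow> 'g set \<Rightarrow> ('g \<Rightarrow> 'a) \<Rightarrow> complex"
  where "pd_form T F h = (\<Sum>s\<in>F. \<Sum>t\<in>F. cinner (T (- t + s) (h s)) (h t))"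

lemma pd_form_mono_neutral:
  assumes "\<And>g. bounded_clinear (T g)" "finite F" "E \<subseteq> F" "\<And>s. s \<in> F - E \<Longrightarrow> h s = 0"
  shows "pd_form T F h = pd_form T E h"
proof -
  have "pd_form T F h = (\<Sum>s\<in>E. \<Sum>t\<in>F. cinner (T (- t + s) (h s)) (h t))"
    unfolding pd_form_def using assms
    by (intro sum.mono_neutral_right) (auto simp: bounded_clinear_zero)
  also have "\<dots> = pd_form T E h"
    unfolding pd_form_def using assms
    by (intro sum.cong refl sum.mono_neutral_right) auto
  finally show ?thesis .
qed

lemma pd_form_cong:
  assumes "\<And>s. s \<in> F \<Longrightarrow> h s = k s"
  shows "pd_form T F h = pd_form T F k"
  unfolding pd_form_def using assms by (intro sum.cong refl) simp

text \<open>The kernel depends only on \<open>- t + s\<close>, where a left translation cancels even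
  without commutativity.\<close>

lemma pd_form_translate:
  "pd_form T ((+) a ` F) h = pd_form T F (\<lambda>s. h (a + s))"
proof -
  have "- (a + t) + (a + s) = - t + s" for s t
    by (simp only: minus_add add.assoc minus_add_cancel)
  then show ?thesis
    unfolding pd_form_def by (simp add: sum.reindex)
qed

lemma pd_form_real_imp_adjoint:
  fixes T :: "'g::group_add \<Rightarrow> 'a::chilbert_space \<Rightarrow> 'a"
  assumes T: "\<And>g. bounded_clinear (T g)"
    and real: "\<And>F h. finite F \<Longrightarrow> Im (pd_form T F h) = 0"
  shows "T (- g) = cadjoint (T g)"
proof -
  have zero: "Im (cinner (T 0 x) x) = 0" for x
    using real[of "{0}" "\<lambda>_. x"] by (simp add: pd_form_def)
  have "Im (cinner (T g y) x + cinner (T (- g) x) y) = 0" for x y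
  \<comment> \<open>For \<open>g = 0\<close> the two points coincide, so \<open>x + y\<close> at a
    single point replaces the two-point function.\<close>
  proof (cases "g = 0")
    case True
    show ?thesis
      using zero[of "x + y"] zero[of x] zero[of y] True
      by (simp add: bounded_clinear_add[OF T] cinner_add_left cinner_add_right)
  next
    case False
    then show ?thesis
      using real[of "{0, g}" "\<lambda>s. if s = 0 then x else y"] zero[of x] zero[of y]
      by (simp add: pd_form_def)
  qed
  then show ?thesis
    using cadjoint_eqI cinner_adjoint_if_real T by metis
qed

text \<open>Absorbs the symmetry condition into the positivity of the form and replaces supports by
  arbitrary finite sets.\<close>

lemma positive_definite_iff_pd_form:
  fixes T :: "'g::group_add \<Rightarrow> 'a::chilbert_space \<Rightarrow> 'a"
  assumes T: "\<And>g. bounded_clinear (T g)"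
  shows "positive_definite T \<longleftrightarrow> (\<forall>F h. finite F \<longrightarrow> pd_form T F h \<in> \<real>\<^sub>\<ge>\<^sub>0)"
proof
  assume pd: "positive_definite T"
  show "\<forall>F h. finite F \<longrightarrow> pd_form T F h \<in> \<real>\<^sub>\<ge>\<^sub>0"
  proof (intro allI impI)
    fix F :: "'g set" and h :: "'g \<Rightarrow> 'a"
    assume F: "finite F"
    \<comment> \<open>Truncation makes the support finite, as the definition of positive
      definiteness requires.\<close>
    define k where "k s = (if s \<in> F then h s else 0)" for s
    have supp: "{s. k s \<noteq> 0} \<subseteq> F"
      by (auto simp: k_def)
    have "pd_form T F h = pd_form T F k"
      by (rule pd_form_cong) (simp add: k_def)
    also have "\<dots> = pd_form T {s. k s \<noteq> 0} k"
      using T F supp by (rule pd_form_mono_neutral) simp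
    finally show "pd_form T F h \<in> \<real>\<^sub>\<ge>\<^sub>0"
      using pd finite_subset[OF supp F] by (simp add: positive_definite_def pd_form_def)
  qed
next
  assume *: "\<forall>F h. finite F \<longrightarrow> pd_form T F h \<in> \<real>\<^sub>\<ge>\<^sub>0"
  then have "Im (pd_form T F h) = 0" if "finite F" for F h
    using that by (auto simp: complex_nonneg_Reals_iff)
  then have "T (- g) = cadjoint (T g)" for g
    by (rule pd_form_real_imp_adjoint[OF T])
  with * show "positive_definite T"
    by (simp add: positive_definite_def pd_form_def)
qed

definition lex_point :: "nat \<Rightarrow> nat \<Rightarrow> int \<times> int" where
  "lex_point n i = map_prod int int (lex_indices n ! i)"

lemma bij_betw_lex_point:
  "bij_betw (lex_point n) {..<(n + 1)\<^sup>2} ({0..int n} \<times> {0..int n})"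
proof -
  have "bij_betw ((!) (lex_indices n)) {..<(n + 1)\<^sup>2} ({0..n} \<times> {0..n})"
    by (rule bij_betw_nth) (simp_all add: lex_indices_def power2_eq_square)
  moreover have "bij_betw (map_prod int int) ({0..n} \<times> {0..n}) ({0..int n} \<times> {0..int n})"
    by (intro bij_betw_map_prod bij_betw_imageI) (simp_all add: image_int_atLeastAtMost)
  ultimately show ?thesis
    by (auto dest: bij_betw_trans simp: lex_point_def comp_def cong: bij_betw_cong)
qed

lemma Delta_eq: "Delta T n i j = T (- lex_point n i + lex_point n j)"
  by (simp add: Delta_def lex_point_def split: prod.split)

lemma power_cinner_Delta:
  fixes T :: "int \<times> int \<Rightarrow> 'h::chilbert_space \<Rightarrow> 'h"
  assumes "\<And>i. i < (n + 1)\<^sup>2 \<Longrightarrow> x i = h (lex_point n i)"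
  shows "power_cinner ((n + 1)\<^sup>2) (block_operator ((n + 1)\<^sup>2) (Delta T n) x) x =
    pd_form T ({0..int n} \<times> {0..int n}) h"
proof -
  let ?N = "(n + 1)\<^sup>2" and ?p = "lex_point n"
  have "power_cinner ?N (block_operator ?N (Delta T n) x) x =
      (\<Sum>i<?N. \<Sum>j<?N. cinner (T (- ?p i + ?p j) (h (?p j))) (h (?p i)))"
    unfolding power_cinner_def block_operator_def Delta_eq
    using assms by (intro sum.cong refl) (simp add: cinner_sum_left)
  \<comment> \<open>Rows play the role of \<open>t\<close> and columns that of \<open>s\<close>,
    while \<open>pd_form\<close> has \<open>s\<close> in the outer sum.\<close>
  also have "\<dots> = (\<Sum>j<?N. \<Sum>i<?N. cinner (T (- ?p i + ?p j) (h (?p j))) (h (?p i)))"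
    by (rule sum.swap)
  also have "\<dots> = pd_form T ({0..int n} \<times> {0..int n}) h"
    unfolding pd_form_def
    by (simp only: sum.reindex_bij_betw[OF bij_betw_lex_point, symmetric])
  finally show ?thesis .
qed

lemma positive_on_power_Delta_iff:
  fixes T :: "int \<times> int \<Rightarrow> 'h::chilbert_space \<Rightarrow> 'h"
  shows "positive_on_power ((n + 1)\<^sup>2) (block_operator ((n + 1)\<^sup>2) (Delta T n)) \<longleftrightarrow>
    (\<forall>h. pd_form T ({0..int n} \<times> {0..int n}) h \<in> \<real>\<^sub>\<ge>\<^sub>0)"
    (is "?pos \<longleftrightarrow> ?form")
proof
  assume pos: ?pos
  show ?form
  proof
    fix h :: "int \<times> int \<Rightarrow> 'h"
    define x where "x i = (if i < (n + 1)\<^sup>2 then h (lex_point n i) else 0)" for i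
    have "x \<in> power_space ((n + 1)\<^sup>2)"
      by (simp add: x_def power_space_def)
    moreover have "power_cinner ((n + 1)\<^sup>2) (block_operator ((n + 1)\<^sup>2) (Delta T n) x) x =
        pd_form T ({0..int n} \<times> {0..int n}) h"
      by (rule power_cinner_Delta) (simp add: x_def)
    ultimately show "pd_form T ({0..int n} \<times> {0..int n}) h \<in> \<real>\<^sub>\<ge>\<^sub>0"
      using pos unfolding positive_on_power_def by metis
  qed
next
  assume form: ?form
  show ?pos
    unfolding positive_on_power_def
  proof
    fix x :: "nat \<Rightarrow> 'h"
    \<comment> \<open>The vector \<open>x\<close> is read as a function on the square; values
      elsewhere do not enter the form.\<close>
    define h where "h s = x (inv_into {..<(n + 1)\<^sup>2} (lex_point n) s)" for s
    have "x i = h (lex_point n i)" if "i < (n + 1)\<^sup>2" for i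
      using bij_betw_inv_into_left[OF bij_betw_lex_point, of i n] that by (simp add: h_def)
    then show "power_cinner ((n + 1)\<^sup>2) (block_operator ((n + 1)\<^sup>2) (Delta T n) x) x \<in> \<real>\<^sub>\<ge>\<^sub>0"
      using form power_cinner_Delta[of n x h T] by simp
  qed
qed

lemma finite_translate_subset_square:
  fixes F :: "(int \<times> int) set"
  assumes "finite F"
  obtains a n where "(+) a ` F \<subseteq> {0..int n} \<times> {0..int n}"
proof -
  \<comment> \<open>A common bound for all coordinates in absolute value, so shifting by
    \<open>(m, m)\<close> moves them into the interval from 0 to \<open>2 * m\<close>.\<close>
  define m where "m = (\<Sum>s\<in>F. \<bar>fst s\<bar> + \<bar>snd s\<bar>)"
  have "(m, m) + s \<in> {0..int (nat (2 * m))} \<times> {0..int (nat (2 * m))}" if "s \<in> F" for s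
  proof -
    have "\<bar>fst s\<bar> + \<bar>snd s\<bar> \<le> m"
      unfolding m_def using that assms by (intro member_le_sum) auto
    then show ?thesis
      by (cases s) auto
  qed
  then have "(+) (m, m) ` F \<subseteq> {0..int (nat (2 * m))} \<times> {0..int (nat (2 * m))}"
    by (rule image_subsetI)
  then show thesis
    by (rule that)
qed

theorem theorem4p4:
  fixes T :: "int \<times> int \<Rightarrow> 'h::chilbert_space \<Rightarrow> 'h"
  assumes "\<And>g. bounded_clinear (T g)"
  shows "positive_definite T \<longleftrightarrow>
    (\<forall>n::nat. positive_on_power ((n + 1)\<^sup>2) (block_operator ((n + 1)\<^sup>2) (Delta T n)))"
proof -
  \<comment> \<open>Passage from squares to all finite sets; the converse merely specializes to
    squares.\<close>
  have "pd_form T F h \<in> \<real>\<^sub>\<ge>\<^sub>0"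
    if form: "\<And>n h. pd_form T ({0..int n} \<times> {0..int n}) h \<in> \<real>\<^sub>\<ge>\<^sub>0" and F: "finite F"
    for F h
  proof -
    obtain a n where sub: "(+) a ` F \<subseteq> {0..int n} \<times> {0..int n}"
      using F by (rule finite_translate_subset_square)
    \<comment> \<open>\<open>h\<close> is carried along by the translation and extended by 0, so
      that filling up to the whole square adds only zero terms.\<close>
    define k where "k s = (if s \<in> (+) a ` F then h (- a + s) else 0)" for s
    have "pd_form T F h = pd_form T F (\<lambda>s. k (a + s))"
      by (rule pd_form_cong) (simp add: k_def)
    also have "\<dots> = pd_form T ((+) a ` F) k"
      by (rule pd_form_translate[symmetric])
    also have "\<dots> = pd_form T ({0..int n} \<times> {0..int n}) k"
      using assms _ sub by (rule pd_form_mono_neutral[symmetric]) (simp_all add: k_def)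
    finally show ?thesis
      using form by simp
  qed
  moreover have "finite ({0..int n} \<times> {0..int n})" for n
    by simp
  ultimately show ?thesis
    unfolding positive_definite_iff_pd_form[OF assms] positive_on_power_Delta_iff by blast
qed

end
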